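(* Let $(\mathcal{R},\oplus,\leqslant)$ be a lattice ordered monoid with neutral element $0$ whose lattice is conditionally complete, let $D=(V,A)$ be a finite digraph with $o,d\in V$, let $(x_a)_{a\in A}\in\mathcal{R}^A$, let $c:\mathcal{R}\to\mathbb{R}$ and $\rho:\mathcal{R}\to\{0,1\}$ be isotone, and for each $v\in V$ let $b_v\in\mathcal{R}$ satisfy $b_v\leqslant x_P$ for every $v$-$d$ path $P$. Suppose that every cycle $C$ in $D$ satisfies $x_C\geqslant 0$. Then the label correcting algorithm (run with the bounds $b_v$) terminates after a finite number of iterations, and at the end, if $c_{od}^{UB}$ is finite, then $c_{od}^{UB}$ is the cost of a non-dominated optimal solution of the Monoid Resource Constrained Shortest Path Problem; otherwise, the problem admits no feasible solution.
   Context: A lattice ordered monoid $(\mathcal{R},\oplus,\leqslant)$ is a monoid $(\mathcal{R},\oplus)$ (associative, with neutral element $0$, possibly non-commutative) with a partial order $\leqslant$ that is a lattice order and is such that all translations $y\mapsto x\oplus y$ and $y\mapsto y\oplus x$ are isotone (order-preserving). Conditionally complete: every nonempty bounded subset has a meet and a join. Paths are finite sequences of arcs, the head of each being the tail of the next; vertices and arcs may be repeated, and empty paths (one at each vertex, with resource $0$) are allowed. A cycle is a nonempty path whose origin equals its destination. The resource of a path $P=(a_1,\dots,a_k)$ is $x_P=x_{a_1}\oplus\cdots\oplus x_{a_k}$. $P$ is feasible if $\rho(x_P)=0$; its cost is $c(x_P)$. The Monoid Resource Constrained Shortest Path Problem asks for a feasible $o$-$d$ path of minimum cost; an optimal solution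 is such a path. An $o$-$v$ path $P$ dominates an $o$-$v$ path $\tilde P$ if $x_P\leqslant x_{\tilde P}$. An optimal solution $P$ is called non-dominated if there is no $o$-$d$ path $Q$ with $x_Q<x_P$. Label correcting algorithm: maintain a list $L$ of paths with origin $o$, a value $c_{od}^{UB}\in\mathbb{R}\cup\{+\infty\}$, and for each vertex $v$ a list $M_v$ of $o$-$v$ paths. Initially $L$ contains only the empty path at $o$, $c_{od}^{UB}=+\infty$, and all $M_v$ are empty. While $L$ is nonempty, repeat: (1) extract (remove) from $L$ a path $P$, with destination denoted $v$, of minimum key $c(x_P\oplus b_v)$ among the paths of $L$ (ties broken arbitrarily); (2) if $v=d$, $\rho(x_P)=0$ and $c(x_P)<c_{od}^{UB}$, then set $c_{od}^{UB}:=c(x_P)$; (3) else, if both the lower bound test "$\rho(x_P\oplus b_v)=0$ and $c(x_P\oplus b_v)\leq c_{od}^{UB}$" and the dominance test "no path in $M_v$ dominates $P$" hold, then remove from $M_v$ and $L$ all the paths of $M_v$ dominated by $P$, add $P$ to $M_v$, and extend $P$: for each arc $a$ outgoing from $v$, add $P+a$ ($P$ followed by $a$) to $L$. *)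

theory Defs
  imports "Graph_Theory.Arc_Walk" "HOL-Library.Extended_Real"
begin

(* The addition need not be commutative: monoid_add only provides associativity and a
   two-sided neutral element. *)
class lattice_ordered_monoid = monoid_add + lattice +
  assumes plus_isotone_left: "y \<le> z \<Longrightarrow> x + y \<le> x + z"
    and plus_isotone_right: "y \<le> z \<Longrightarrow> y + x \<le> z + x"

(* Conditional completeness is the class conditionally_complete_lattice, which asks for joins of
   nonempty sets bounded above and meets of nonempty sets bounded below.  In a lattice this is
   the same as asking for both on nonempty sets bounded on both sides: for s in S, the set S and
   {sup s t | t in S} have the same upper bounds, and the latter set is bounded below by s. *)

definition path_resource :: "('a \<Rightarrow> 'r::monoid_add) \<Rightarrow> 'a awalk \<Rightarrow> 'r" where
  "path_resource x P = sum_list (map x P)"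

definition feasible_path ::
  "('v, 'a) pre_digraph \<Rightarrow> 'v \<Rightarrow> 'v \<Rightarrow> ('a \<Rightarrow> 'r::monoid_add) \<Rightarrow> ('r \<Rightarrow> nat) \<Rightarrow> 'a awalk \<Rightarrow> bool" where
  "feasible_path D org dst x \<rho> P \<longleftrightarrow>
     pre_digraph.awalk D org P dst \<and> \<rho> (path_resource x P) = 0"

definition optimal_path ::
  "('v, 'a) pre_digraph \<Rightarrow> 'v \<Rightarrow> 'v \<Rightarrow> ('a \<Rightarrow> 'r::monoid_add) \<Rightarrow> ('r \<Rightarrow> real) \<Rightarrow> ('r \<Rightarrow> nat) \<Rightarrow>
     'a awalk \<Rightarrow> bool" where
  "optimal_path D org dst x c \<rho> P \<longleftrightarrow>
     feasible_path D org dst x \<rho> P \<and>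
     (\<forall>Q. feasible_path D org dst x \<rho> Q \<longrightarrow> c (path_resource x P) \<le> c (path_resource x Q))"

definition nondominated_optimal_path ::
  "('v, 'a) pre_digraph \<Rightarrow> 'v \<Rightarrow> 'v \<Rightarrow> ('a \<Rightarrow> 'r::{monoid_add, order}) \<Rightarrow> ('r \<Rightarrow> real) \<Rightarrow> ('r \<Rightarrow> nat) \<Rightarrow>
     'a awalk \<Rightarrow> bool" where
  "nondominated_optimal_path D org dst x c \<rho> P \<longleftrightarrow>
     optimal_path D org dst x c \<rho> P \<and>
     \<not> (\<exists>Q. pre_digraph.awalk D org Q dst \<and> path_resource x Q < path_resource x P)"

definition dominates :: "('a \<Rightarrow> 'r::{monoid_add, order}) \<Rightarrow> 'a awalk \<Rightarrow> 'a awalk \<Rightarrow> bool" where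
  "dominates x P Q \<longleftrightarrow> path_resource x P \<le> path_resource x Q"

(* The collections L and M_v are unordered, hence sets.  A path P + a enters L only when P is
   extended, which happens at most once, so no multiplicities are lost.  All stored paths start
   at the origin, so the arc list alone determines the path, including the empty one. *)
record ('v, 'a) lc_state =
  todo :: "'a awalk set"
  ub :: ereal
  labels :: "'v \<Rightarrow> 'a awalk set"

definition lc_init :: "('v, 'a) lc_state" where
  "lc_init = \<lparr>todo = {[]}, ub = \<infinity>, labels = (\<lambda>v. {})\<rparr>"

definition lc_process ::
  "('v, 'a) pre_digraph \<Rightarrow> 'v \<Rightarrow> 'v \<Rightarrow> ('a \<Rightarrow> 'r::{monoid_add, order}) \<Rightarrow> ('r \<Rightarrow> real) \<Rightarrow> ('r \<Rightarrow> nat) \<Rightarrow>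
     ('v \<Rightarrow> 'r) \<Rightarrow> 'a awalk \<Rightarrow> ('v, 'a) lc_state \<Rightarrow> ('v, 'a) lc_state" where
  "lc_process D org dst x c \<rho> b P s =
    (let v = pre_digraph.awlast D org P;
         r = path_resource x P;
         L = todo s - {P};
         M = labels s v;
         Dom = {Q \<in> M. dominates x P Q}
     in if v = dst \<and> \<rho> r = 0 \<and> ereal (c r) < ub s
        then s\<lparr>todo := L, ub := ereal (c r)\<rparr>
        else if (\<rho> (r + b v) = 0 \<and> ereal (c (r + b v)) \<le> ub s) \<and> \<not> (\<exists>Q\<in>M. dominates x Q P)
        then s\<lparr>todo := (L - Dom) \<union> {P @ [a] | a. a \<in> out_arcs D v},
               labels := (labels s)(v := insert P (M - Dom))\<rparr>
        else s\<lparr>todo := L\<rparr>)"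

(* One iteration, as a relation because ties between minimum keys are broken arbitrarily. *)
definition lc_step ::
  "('v, 'a) pre_digraph \<Rightarrow> 'v \<Rightarrow> 'v \<Rightarrow> ('a \<Rightarrow> 'r::{monoid_add, order}) \<Rightarrow> ('r \<Rightarrow> real) \<Rightarrow> ('r \<Rightarrow> nat) \<Rightarrow>
     ('v \<Rightarrow> 'r) \<Rightarrow> ('v, 'a) lc_state \<Rightarrow> ('v, 'a) lc_state \<Rightarrow> bool" where
  "lc_step D org dst x c \<rho> b s s' \<longleftrightarrow>
     (\<exists>P. is_arg_min (\<lambda>Q. c (path_resource x Q + b (pre_digraph.awlast D org Q)))
            (\<lambda>Q. Q \<in> todo s) P \<and>
          s' = lc_process D org dst x c \<rho> b P s)"

end

(* Each path enters the list at most once, and a path containing a cycle is dominated by a label at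
   the vertex it revisits, so only elementary paths are extended and only finitely many paths are
   ever extracted.  For correctness, keep for every open resource r (feasible and cheaper than the
   current bound) of a concatenation Q, R with Q a label at the origin of R a witness in the list:
   a path Q' with a completion R' strictly shorter than R and x_Q' + x_R' \<le> r.  The list being
   empty at the end, no feasible path beats the bound.  A nondominated optimal path exists because
   removing cycles does not increase resources and there are finitely many elementary paths. *)

theory Submission
  imports Defs
begin

lemma path_resource_Nil [simp]: "path_resource x [] = 0"
  by (simp add: path_resource_def)

lemma path_resource_append [simp]:
  "path_resource x (P @ Q) = path_resource x P + path_resource x Q"
  by (simp add: path_resource_def)

lemma path_resource_Cons: "path_resource x (a # P) = x a + path_resource x P"
  by (simp add: path_resource_def)

locale resource_constrained_path = fin_digraph D
  for D :: "('v, 'a) pre_digraph" +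
  fixes org dst :: 'v
    and x :: "'a \<Rightarrow> 'r::lattice_ordered_monoid"
    and c :: "'r \<Rightarrow> real"
    and \<rho> :: "'r \<Rightarrow> nat"
    and b :: "'v \<Rightarrow> 'r"
  assumes org_in_verts: "org \<in> verts D"
    and mono_c: "mono c"
    and mono_\<rho>: "mono \<rho>"
    and lower_bound: "\<And>v P. v \<in> verts D \<Longrightarrow> awalk v P dst \<Longrightarrow> b v \<le> path_resource x P"
    and closed_w_nonneg: "\<And>C. closed_w C \<Longrightarrow> 0 \<le> path_resource x C"
begin

section \<open>Cycle removal and non-dominated optimal paths\<close>

lemma c_le: "r \<le> r' \<Longrightarrow> c r \<le> c r'"
  using mono_c by (rule monoD)

lemma \<rho>_eq_0: "r \<le> r' \<Longrightarrow> \<rho> r' = 0 \<Longrightarrow> \<rho> r = 0"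
  using monoD[OF mono_\<rho>] by fastforce

lemma closed_awalk_nonneg: "awalk u P u \<Longrightarrow> 0 \<le> path_resource x P"
  by (cases "P = []") (auto intro!: closed_w_nonneg simp: closed_w_def)

lemma le_plus_closed_awalk:
  assumes "awalk u P u"
  shows "r \<le> r + path_resource x P"
  using plus_isotone_left[OF closed_awalk_nonneg[OF assms], of r] by simp

text \<open>Cutting a closed subwalk \<open>r\<close> out of \<open>q @ r @ s\<close> cannot raise
  the resource: translation on the left by \<open>q\<close> and then on the right by
  \<open>s\<close> preserves \<open>0 \<le> path_resource x r\<close>. Each cut shortens the walk,
  so induction on the length ends at an elementary path.\<close>

lemma apath_le_awalk:
  assumes "awalk u P v"
  shows "\<exists>Q. apath u Q v \<and> path_resource x Q \<le> path_resource x P"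
  using assms
proof (induction "length P" arbitrary: P rule: less_induct)
  case less
  show ?case
  proof (cases "distinct (awalk_verts u P)")
    case True
    then show ?thesis using less.prems by (auto simp: apath_def)
  next
    case False
    then obtain q r s w where P: "P = q @ r @ s" "0 < length r"
      and w: "awalk u q w" "awalk w r w" "awalk w s v"
      using awalk_not_distinct_decomp[OF less.prems] by blast
    have "awalk u (q @ s) v" using w by (blast intro: awalk_appendI)
    then obtain Q where Q: "apath u Q v" "path_resource x Q \<le> path_resource x (q @ s)"
      using less.hyps[of "q @ s"] P by auto
    have "path_resource x q + path_resource x s \<le>
        path_resource x q + path_resource x r + path_resource x s"
      by (rule plus_isotone_right[OF le_plus_closed_awalk[OF w(2)]])
    then show ?thesis using Q P by (auto simp: add.assoc intro: order_trans)
  qed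
qed

text \<open>Descend from \<open>P\<close> to an elementary path, then to one of minimal resource
  among the elementary paths. Going down in resource preserves feasibility and never raises the
  cost, so optimality survives.\<close>

lemma nondominated_optimal_path_exists:
  assumes "optimal_path D org dst x c \<rho> P"
  shows "\<exists>Q. nondominated_optimal_path D org dst x c \<rho> Q \<and>
    c (path_resource x Q) = c (path_resource x P)"
proof -
  have P: "awalk org P dst" "\<rho> (path_resource x P) = 0"
    and opt: "\<And>Q. awalk org Q dst \<Longrightarrow> \<rho> (path_resource x Q) = 0 \<Longrightarrow>
      c (path_resource x P) \<le> c (path_resource x Q)"
    using assms by (auto simp: optimal_path_def feasible_path_def)
  obtain P' where P': "apath org P' dst" "path_resource x P' \<le> path_resource x P"
    using apath_le_awalk[OF P(1)] by blast
  have fin: "finite (path_resource x ` {Q. apath org Q dst})"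
    using apaths_finite by blast
  have "path_resource x P' \<in> path_resource x ` {Q. apath org Q dst}"
    using P' by blast
  from finite_has_minimal2[OF fin this] obtain m where m: "m \<in> path_resource x ` {Q. apath org Q dst}"
    "m \<le> path_resource x P'"
    and min: "\<And>r. r \<in> path_resource x ` {Q. apath org Q dst} \<Longrightarrow> r \<le> m \<Longrightarrow> m = r"
    by blast
  obtain Q where Q: "apath org Q dst" "m = path_resource x Q" using m by blast
  have QP: "path_resource x Q \<le> path_resource x P" using m P' Q by auto
  have feas: "awalk org Q dst" "\<rho> (path_resource x Q) = 0"
    using Q \<rho>_eq_0[OF QP P(2)] by (auto intro: awalkI_apath)
  have cost: "c (path_resource x Q) = c (path_resource x P)"
    using c_le[OF QP] opt[OF feas] by simp
  \<comment> \<open>Minimality of \<open>m\<close> concerns elementary paths only, so a competing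
    walk is first reduced to one of these.\<close>
  have "\<not> path_resource x R < path_resource x Q" if "awalk org R dst" for R
  proof
    assume less: "path_resource x R < path_resource x Q"
    obtain R' where R': "apath org R' dst" "path_resource x R' \<le> path_resource x R"
      using apath_le_awalk[OF \<open>awalk org R dst\<close>] by blast
    then have "m = path_resource x R'" using min less Q by auto
    then show False using R' less Q by auto
  qed
  then have "nondominated_optimal_path D org dst x c \<rho> Q"
    using feas opt cost
    by (auto simp: nondominated_optimal_path_def optimal_path_def feasible_path_def)
  then show ?thesis using cost by blast
qed

section \<open>Iterations, and the invariant on listed and extracted paths\<close>

abbreviation process :: "'a awalk \<Rightarrow> ('v, 'a) lc_state \<Rightarrow> ('v, 'a) lc_state" where
  "process \<equiv> lc_process D org dst x c \<rho> b"

abbreviation step :: "('v, 'a) lc_state \<Rightarrow> ('v, 'a) lc_state \<Rightarrow> bool" where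
  "step \<equiv> lc_step D org dst x c \<rho> b"

definition improving :: "'a awalk \<Rightarrow> ('v, 'a) lc_state \<Rightarrow> bool" where
  "improving P s \<longleftrightarrow> awlast org P = dst \<and> \<rho> (path_resource x P) = 0 \<and>
    ereal (c (path_resource x P)) < ub s"

definition within_bound :: "'a awalk \<Rightarrow> ('v, 'a) lc_state \<Rightarrow> bool" where
  "within_bound P s \<longleftrightarrow> \<rho> (path_resource x P + b (awlast org P)) = 0 \<and>
    ereal (c (path_resource x P + b (awlast org P))) \<le> ub s"

definition dominated :: "'a awalk \<Rightarrow> ('v, 'a) lc_state \<Rightarrow> bool" where
  "dominated P s \<longleftrightarrow> (\<exists>Q\<in>labels s (awlast org P). dominates x Q P)"

text \<open>The case \<open>extend\<close> keeps the failed test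
  \<open>\<not> improving P s\<close>: coverage later needs that an extended path is not itself an
  improvement.\<close>

lemma process_cases:
  obtains
    (improve) "improving P s"
      "process P s = s\<lparr>todo := todo s - {P}, ub := ereal (c (path_resource x P))\<rparr>"
  | (extend) "\<not> improving P s" "within_bound P s" "\<not> dominated P s"
      "process P s =
        s\<lparr>todo := (todo s - {P} - {Q \<in> labels s (awlast org P). dominates x P Q}) \<union>
             {P @ [a] | a. a \<in> out_arcs D (awlast org P)},
          labels := (labels s)(awlast org P :=
             insert P (labels s (awlast org P) -
               {Q \<in> labels s (awlast org P). dominates x P Q}))\<rparr>"
  | (reject) "\<not> improving P s" "\<not> within_bound P s \<or> dominated P s"
      "process P s = s\<lparr>todo := todo s - {P}\<rparr>"
proof (cases "improving P s")
  case True
  then show ?thesis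
    using improve by (simp add: lc_process_def Let_def improving_def)
next
  case ni: False
  show ?thesis
  proof (cases "within_bound P s \<and> \<not> dominated P s")
    case True
    then show ?thesis
      using ni by (intro extend) (auto simp: lc_process_def Let_def improving_def
        within_bound_def dominated_def simp del: in_out_arcs_conv)
  next
    case False
    then have "process P s = s\<lparr>todo := todo s - {P}\<rparr>"
      using ni unfolding lc_process_def Let_def improving_def within_bound_def dominated_def
      by (simp only: if_False)
    then show ?thesis using reject[OF ni] False by blast
  qed
qed

(* E is a ghost variable: the set of paths extracted so far. *)
definition explored :: "('v, 'a) lc_state \<Rightarrow> 'a awalk set \<Rightarrow> bool" where
  "explored s E \<longleftrightarrow>
     (\<forall>P\<in>todo s \<union> E. awalk org P (awlast org P)) \<and>
     todo s \<inter> E = {} \<and>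
     (\<forall>v. \<forall>P\<in>labels s v. P \<in> E \<and> awlast org P = v) \<and>
     (\<forall>P a. P @ [a] \<in> todo s \<union> E \<longrightarrow>
        P \<in> E \<and> apath org P (awlast org P) \<and> dominated P s) \<and>
     (ub s = \<infinity> \<or>
       (\<exists>P. feasible_path D org dst x \<rho> P \<and> ub s = ereal (c (path_resource x P))))"

lemma explored_init: "explored lc_init {}"
  using org_in_verts by (auto simp: explored_def lc_init_def awalk_Nil_iff)

text \<open>The invariant only describes the removal of a last arc; iterating it from the right end
  reaches every proper prefix.\<close>

lemma explored_prefix:
  assumes "explored s E" "P @ Q \<in> todo s \<union> E" "Q \<noteq> []"
  shows "P \<in> E \<and> apath org P (awlast org P) \<and> dominated P s"
  using assms(2,3)
proof (induction Q rule: rev_induct)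
  case Nil
  then show ?case by simp
next
  case (snoc a Q)
  have step: "R \<in> E \<and> apath org R (awlast org R) \<and> dominated R s"
    if "R @ [a] \<in> todo s \<union> E" for R a
    using assms(1) that unfolding explored_def by blast
  have PQ: "P @ Q \<in> E \<and> apath org (P @ Q) (awlast org (P @ Q)) \<and> dominated (P @ Q) s"
    using step snoc.prems by simp
  show ?case
  proof (cases "Q = []")
    case True
    then show ?thesis using PQ by simp
  next
    case False
    then show ?thesis using snoc.IH PQ by blast
  qed
qed

text \<open>A path that returns to a vertex \<open>w\<close> has at least the resource of its prefix
  ending at the first of the two visits. That prefix has been extracted and is dominated by a label
  at \<open>w\<close>, and this label dominates the longer path too.\<close>

lemma undominated_apath:
  assumes expl: "explored s E" and P: "P \<in> todo s \<union> E" and undom: "\<not> dominated P s"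
  shows "apath org P (awlast org P)"
proof (rule ccontr)
  assume no: "\<not> apath org P (awlast org P)"
  have aw: "awalk org P (awlast org P)" using expl P unfolding explored_def by blast
  then have "\<not> distinct (awalk_verts org P)" using no by (simp add: apath_def)
  then obtain q r s' w where dec: "P = q @ r @ s'" "0 < length r"
    and w: "awalk org q w" "awalk w r w" "awalk w s' (awlast org P)"
    using awalk_not_distinct_decomp[OF aw] by blast
  have r: "r \<noteq> []" using dec by simp
  have qr: "awalk org (q @ r) w" using w by (blast intro: awalk_appendI)
  \<comment> \<open>Otherwise \<open>q @ r\<close> is a proper prefix, hence elementary, although it
    contains the cycle \<open>r\<close>. So the cycle closes at the last vertex of
    \<open>P\<close>.\<close>
  have "s' = []"
  proof (rule ccontr)
    assume "s' \<noteq> []"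
    then have "apath org (q @ r) (awlast org (q @ r))"
      using explored_prefix[OF expl, of "q @ r" s'] P dec by simp
    then have "apath (awlast org q) r (awlast (awlast org q) r)"
      by (simp add: apath_append_iff awlast_append)
    then have "apath w r w" using w by simp
    then show False using r apath_nonempty_ends by blast
  qed
  then have last: "awlast org P = w" "awlast org q = w" using dec w qr by auto
  have "dominated q s"
    using explored_prefix[OF expl, of q r] P dec r \<open>s' = []\<close> by simp
  then obtain Q where "Q \<in> labels s w" "path_resource x Q \<le> path_resource x q"
    using last by (auto simp: dominated_def dominates_def)
  moreover have "path_resource x q \<le> path_resource x P"
    using le_plus_closed_awalk[OF w(2)] dec \<open>s' = []\<close> by simp
  ultimately have "dominated P s"
    using last by (auto simp: dominated_def dominates_def intro: order_trans)
  then show False using undom by simp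
qed

text \<open>A label is deleted only in favour of a new label that dominates it, which takes over its
  role by transitivity.\<close>

lemma dominated_process: "dominated Q s \<Longrightarrow> dominated Q (process P s)"
proof (cases rule: process_cases[of P s])
  case extend
  assume "dominated Q s"
  then obtain R where R: "R \<in> labels s (awlast org Q)" "dominates x R Q"
    by (auto simp: dominated_def)
  show ?thesis
  proof (cases "awlast org Q = awlast org P \<and> dominates x P R")
    case True
    then have "dominates x P Q" using R(2) by (auto simp: dominates_def intro: order_trans)
    then show ?thesis using True unfolding dominated_def extend(4) by simp
  next
    case False
    then have "R \<in> labels (process P s) (awlast org Q)"
      using R(1) unfolding extend(4) by auto
    then show ?thesis using R(2) by (auto simp: dominated_def)
  qed
qed (simp_all add: dominated_def)

lemma explored_process:
  assumes expl: "explored s E" and P: "P \<in> todo s"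
  shows "explored (process P s) (insert P E)"
proof -
  have walk: "awalk org Q (awlast org Q)" if "Q \<in> todo s \<union> E" for Q
    using expl that unfolding explored_def by blast
  have disj: "todo s \<inter> E = {}" using expl unfolding explored_def by blast
  have lab: "Q \<in> E" "awlast org Q = v" if "Q \<in> labels s v" for Q v
    using expl that unfolding explored_def by blast+
  have pre: "Q \<in> E" "apath org Q (awlast org Q)" "dominated Q s"
    if "Q @ [a] \<in> todo s \<union> E" for Q a
    using expl that unfolding explored_def by blast+
  have bound: "ub s = \<infinity> \<or>
      (\<exists>P. feasible_path D org dst x \<rho> P \<and> ub s = ereal (c (path_resource x P)))"
    using expl unfolding explored_def by blast
  have PE: "P \<notin> E" using P disj by blast
  define s' where "s' = process P s"
  let ?new = "{P @ [a] | a. a \<in> out_arcs D (awlast org P)}"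
  have keep: "dominated Q s'" if "dominated Q s" for Q
    using dominated_process[OF that] unfolding s'_def .
  \<comment> \<open>These facts hold in all three branches and suffice for the invariant. The third
    says that the list gains paths only if \<open>P\<close> was extended, and then \<open>P\<close>,
    as a fresh label, dominates itself.\<close>
  have "todo s' \<subseteq> todo s - {P} \<union> ?new \<and>
      (\<forall>v. labels s' v \<subseteq> labels s v \<union> {Q. Q = P \<and> v = awlast org P}) \<and>
      (todo s' \<subseteq> todo s \<or> apath org P (awlast org P) \<and> dominated P s') \<and>
      (ub s' = \<infinity> \<or>
        (\<exists>P. feasible_path D org dst x \<rho> P \<and> ub s' = ereal (c (path_resource x P))))"
  proof (cases rule: process_cases[of P s])
    case improve
    have "feasible_path D org dst x \<rho> P"
      using improve(1) walk[of P] P by (auto simp: improving_def feasible_path_def)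
    then show ?thesis unfolding s'_def improve(2) by auto
  next
    case extend
    have "apath org P (awlast org P)"
      using undominated_apath[OF expl _ extend(3)] P by simp
    moreover have "dominated P s'"
      unfolding s'_def extend(4) by (auto simp: dominated_def dominates_def)
    moreover have "ub s' = ub s" unfolding s'_def extend(4) by simp
    moreover have "todo s' \<subseteq> todo s - {P} \<union> ?new" unfolding s'_def extend(4) by force
    moreover have "labels s' v \<subseteq> labels s v \<union> {Q. Q = P \<and> v = awlast org P}" for v
      unfolding s'_def extend(4) by auto
    ultimately show ?thesis using bound by simp
  next
    case reject
    show ?thesis using bound unfolding s'_def reject(3) by auto
  qed
  then have todo: "todo s' \<subseteq> todo s - {P} \<union> ?new"
    and labs: "\<And>v. labels s' v \<subseteq> labels s v \<union> {Q. Q = P \<and> v = awlast org P}"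
    and new: "todo s' \<subseteq> todo s \<or> apath org P (awlast org P) \<and> dominated P s'"
    and bound': "ub s' = \<infinity> \<or>
      (\<exists>P. feasible_path D org dst x \<rho> P \<and> ub s' = ereal (c (path_resource x P)))"
    by blast+
  have new_walk: "awalk org Q (awlast org Q)" if "Q \<in> ?new" for Q
    using that walk[of P] P
    by (auto simp: awlast_append awalk_simps head_in_verts)
  \<comment> \<open>Had \<open>P @ [a]\<close> been extracted before, its prefix \<open>P\<close>
    would have been too.\<close>
  have new_notin: "Q \<notin> insert P E" if "Q \<in> ?new" for Q
    using that pre(1) PE by auto
  have pre': "Q \<in> insert P E \<and> apath org Q (awlast org Q) \<and> dominated Q s'"
    if "Q @ [a] \<in> todo s' \<union> insert P E" for Q a
  proof (cases "Q @ [a] \<in> todo s \<union> E")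
    case True
    then show ?thesis using pre keep by blast
  next
    case False
    then have "Q @ [a] \<in> todo s'" "Q @ [a] \<in> ?new" using that todo P by blast+
    then have "Q = P" "\<not> todo s' \<subseteq> todo s" using False by auto
    then show ?thesis using new by blast
  qed
  show ?thesis
    unfolding explored_def s'_def[symmetric]
  proof (intro conjI allI ballI impI)
    fix Q assume "Q \<in> todo s' \<union> insert P E"
    then show "awalk org Q (awlast org Q)" using todo new_walk walk P by blast
  next
    show "todo s' \<inter> insert P E = {}" using todo new_notin disj by blast
  next
    fix v Q assume "Q \<in> labels s' v"
    then have "Q \<in> labels s v \<or> Q = P \<and> v = awlast org P" using labs by blast
    then show "Q \<in> insert P E" "awlast org Q = v" using lab by blast+
  qed (use pre' bound' in blast)+
qed

section \<open>Termination\<close>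

text \<open>The extra arc is needed because a listed path may revisit a vertex with its last arc,
  before being rejected; only its prefix without that arc is known to be elementary.\<close>

definition extracted_bound :: "'a awalk set" where
  "extracted_bound = insert [] ((\<lambda>(P, a). P @ [a]) `
     ((\<Union>v\<in>verts D. {P. apath org P v}) \<times> arcs D))"

lemma finite_extracted_bound: "finite extracted_bound"
  unfolding extracted_bound_def using apaths_finite by simp

lemma explored_subset:
  assumes "explored s E"
  shows "todo s \<union> E \<subseteq> extracted_bound"
proof
  fix P assume P: "P \<in> todo s \<union> E"
  show "P \<in> extracted_bound"
  proof (cases P rule: rev_cases)
    case Nil
    then show ?thesis by (simp add: extracted_bound_def)
  next
    case (snoc Q a)
    have "apath org Q (awlast org Q)"
      using assms P snoc unfolding explored_def by blast
    moreover have "awalk org P (awlast org P)" using assms P unfolding explored_def by blast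
    then have "a \<in> arcs D" "awlast org Q \<in> verts D"
      using snoc by (auto simp: awalk_simps awlast_append)
    ultimately show ?thesis using snoc unfolding extracted_bound_def by force
  qed
qed

lemma step_process:
  assumes "step s s'"
  obtains P where "P \<in> todo s" "s' = process P s"
  using assms by (auto simp: lc_step_def is_arg_min_def)

text \<open>The list is disjoint from the extracted paths, so each iteration enlarges
  \<open>E\<close> by exactly one path, while \<open>E\<close> stays inside a fixed finite
  set.\<close>

lemma no_infinite_run: "\<not> (\<exists>S. S 0 = lc_init \<and> (\<forall>n. step (S n) (S (Suc n))))"
proof
  assume "\<exists>S. S 0 = lc_init \<and> (\<forall>n. step (S n) (S (Suc n)))"
  then obtain S where S: "S 0 = lc_init" "\<And>n. step (S n) (S (Suc n))" by blast
  have "\<exists>E. explored (S n) E \<and> card E = n" for n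
  proof (induction n)
    case 0
    then show ?case using explored_init S(1) by auto
  next
    case (Suc n)
    then obtain E where E: "explored (S n) E" "card E = n" by blast
    obtain P where P: "P \<in> todo (S n)" "S (Suc n) = process P (S n)"
      using step_process[OF S(2)] .
    have "P \<notin> E" using E P unfolding explored_def by blast
    moreover have "finite E"
      using explored_subset[OF E(1)] finite_extracted_bound finite_subset by blast
    ultimately have "card (insert P E) = Suc n" using E by simp
    then show ?case using explored_process[OF E(1) P(1)] P(2) by auto
  qed
  then obtain E where E: "explored (S (Suc (card extracted_bound))) E"
    "card E = Suc (card extracted_bound)" by blast
  then show False
    using explored_subset[OF E(1)] card_mono[OF finite_extracted_bound, of E] by auto
qed

text \<open>A finite nonempty list has a path of minimum key, which enables a step.\<close>

lemma stuck_todo_empty: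
  assumes "explored s E" and stuck: "\<nexists>s'. step s s'"
  shows "todo s = {}"
proof (rule ccontr)
  assume "todo s \<noteq> {}"
  moreover have "finite (todo s)"
    using explored_subset[OF assms(1)] finite_extracted_bound finite_subset by blast
  ultimately obtain P where "is_arg_min
      (\<lambda>Q. c (path_resource x Q + b (awlast org Q))) (\<lambda>Q. Q \<in> todo s) P"
    using ex_is_arg_min_if_finite by blast
  then show False using stuck unfolding lc_step_def by blast
qed

section \<open>Coverage of improving resources, and correctness\<close>

definition open_resource :: "('v, 'a) lc_state \<Rightarrow> 'r \<Rightarrow> bool" where
  "open_resource s r \<longleftrightarrow> \<rho> r = 0 \<and> ereal (c r) < ub s"

text \<open>The strict bound \<open>n\<close> on the completion length is a decreasing measure: it
  keeps the replacement of a rejected witness by a dominating label from going on forever.\<close>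

definition covered :: "('v, 'a) lc_state \<Rightarrow> 'r \<Rightarrow> nat \<Rightarrow> bool" where
  "covered s r n \<longleftrightarrow> (\<exists>Q\<in>todo s. \<exists>R. awalk (awlast org Q) R dst \<and> length R < n \<and>
     path_resource x Q + path_resource x R \<le> r)"

text \<open>Once the list is empty nothing is covered, so the first clause rules out any remaining
  improvement. The second clause makes the first inductive: it supplies a new witness when a listed
  one is rejected by dominance.\<close>

definition covering :: "('v, 'a) lc_state \<Rightarrow> bool" where
  "covering s \<longleftrightarrow>
     (\<forall>R. awalk org R dst \<longrightarrow> open_resource s (path_resource x R) \<longrightarrow>
        (\<exists>n. covered s (path_resource x R) n)) \<and>
     (\<forall>v. \<forall>Q\<in>labels s v. \<forall>R. awalk v R dst \<longrightarrow>
        open_resource s (path_resource x Q + path_resource x R) \<longrightarrow>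
        covered s (path_resource x Q + path_resource x R) (length R))"

lemma covering_init: "covering lc_init"
  by (auto simp: covering_def lc_init_def covered_def)

lemma covered_mono: "covered s r n \<Longrightarrow> r \<le> r' \<Longrightarrow> n \<le> n' \<Longrightarrow> covered s r' n'"
  unfolding covered_def by (meson order_trans less_le_trans)

lemma open_resource_antimono: "open_resource s r \<Longrightarrow> r' \<le> r \<Longrightarrow> open_resource s r'"
  using c_le \<rho>_eq_0 unfolding open_resource_def
  by (meson ereal_less_eq(3) le_less_trans)

lemma ub_process_le: "ub (process P s) \<le> ub s"
  by (cases rule: process_cases[of P s]) (auto simp: improving_def)

lemma open_resource_process: "open_resource (process P s) r \<Longrightarrow> open_resource s r"
  using ub_process_le unfolding open_resource_def by (meson less_le_trans)

text \<open>The first arc of the completion moves over to the listed path, which leaves a completion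
  shorter by one arc.\<close>

lemma extended_covered:
  assumes "\<not> improving P s" "process P s = s\<lparr>todo := T \<union>
      {P @ [a] | a. a \<in> out_arcs D (awlast org P)}, labels := M\<rparr>"
    and R: "awalk (awlast org P) R dst"
    and op: "open_resource s (path_resource x P + path_resource x R)"
  shows "covered (process P s) (path_resource x P + path_resource x R) (length R)"
proof (cases R)
  case Nil
  \<comment> \<open>With an empty completion, \<open>P\<close> ends at \<open>dst\<close> and its
    own resource is open.\<close>
  then have "improving P s"
    using R op by (simp add: improving_def open_resource_def awalk_Nil_iff)
  then show ?thesis using assms(1) by simp
next
  case (Cons a R')
  then have "a \<in> out_arcs D (awlast org P)" "awalk (awlast org (P @ [a])) R' dst"
    using R by (auto simp: awalk_simps awlast_append)
  then show ?thesis
    unfolding covered_def assms(2) using Cons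
    by (intro bexI[of _ "P @ [a]"] exI[of _ R']) (auto simp: path_resource_Cons add.assoc)
qed

text \<open>Only the extraction of the witness itself can harm coverage. Then the bound drops too
  far for \<open>r\<close> to stay open, or a child of \<open>P\<close> is the new witness, or a
  dominating label leads to a witness with a shorter completion.\<close>

lemma covered_process:
  assumes expl: "explored s E" and cov: "covering s" and P: "P \<in> todo s"
    and op: "open_resource (process P s) r"
    and "covered s r n"
  shows "covered (process P s) r n"
  using \<open>covered s r n\<close>
proof (induction n rule: less_induct)
  case (less n)
  then obtain Q R where Q: "Q \<in> todo s" and R: "awalk (awlast org Q) R dst" "length R < n"
    and le: "path_resource x Q + path_resource x R \<le> r"
    unfolding covered_def by blast
  \<comment> \<open>Labels are extracted paths, so the deletion of dominated labels cannot take
    \<open>Q\<close> off the list.\<close>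
  have "Q \<notin> labels s v" for v
    using expl Q unfolding explored_def by blast
  then have keep: "Q \<in> todo (process P s)" if "Q \<noteq> P"
    using that Q by (cases rule: process_cases[of P s]) auto
  have op': "open_resource s (path_resource x Q + path_resource x R)"
    using op le open_resource_process open_resource_antimono by blast
  have verts: "awlast org Q \<in> verts D" using R by auto
  have bound: "path_resource x P + b (awlast org P) \<le> path_resource x P + path_resource x R"
    if "Q = P"
    using that lower_bound[OF verts R(1)] by (simp add: plus_isotone_left)
  show ?case
  proof (cases "Q = P")
    case False
    then show ?thesis using keep R le unfolding covered_def by blast
  next
    case True
    note PR = R(1)[unfolded True] and le' = le[unfolded True] and op' = op'[unfolded True]
    \<comment> \<open>As \<open>b\<close> lies below the resource of every completion, an open
      resource forces the lower bound test to succeed; a rejection can then only come from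
      dominance.\<close>
    have within: "within_bound P s"
      using open_resource_antimono[OF op' bound[OF True]]
      by (auto simp: within_bound_def open_resource_def)
    show ?thesis
    proof (cases rule: process_cases[of P s])
      case improve
      then have "awlast org P = dst" by (simp add: improving_def)
      \<comment> \<open>Here \<open>R\<close> is a closed walk at \<open>dst\<close>, so
        \<open>r\<close> lies above the resource of \<open>P\<close>, whose cost is the new bound.
        Hence \<open>r\<close> is not open afterwards, a contradiction.\<close>
      then have "path_resource x P \<le> path_resource x P + path_resource x R"
        using PR le_plus_closed_awalk by simp
      then have "open_resource (process P s) (path_resource x P)"
        using op le' open_resource_antimono by (meson order_trans)
      then show ?thesis unfolding open_resource_def improve(2) by simp
    next
      case extend
      show ?thesis
        using extended_covered[OF extend(1,4) PR op'] le' R(2)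
        by (meson covered_mono less_imp_le)
    next
      case reject
      then obtain Q' where Q': "Q' \<in> labels s (awlast org P)"
        "path_resource x Q' \<le> path_resource x P"
        using within by (auto simp: dominated_def dominates_def)
      have le2: "path_resource x Q' + path_resource x R \<le> path_resource x P + path_resource x R"
        by (rule plus_isotone_right[OF Q'(2)])
      \<comment> \<open>The label clause in the old state gives completions shorter than
        \<open>R\<close>, and \<open>length R < n\<close> lets the induction hypothesis carry them
        to the new state.\<close>
      have "covered s (path_resource x Q' + path_resource x R) (length R)"
        using cov Q'(1) PR open_resource_antimono[OF op' le2] unfolding covering_def by blast
      then have "covered s r (length R)"
        using le2 le' by (meson covered_mono order_trans order_refl)
      then show ?thesis
        using less.IH[OF R(2)] R(2) by (meson covered_mono less_imp_le order_refl)
    qed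
  qed
qed

text \<open>Old labels keep their coverage by \<open>covered_process\<close>. The only label that
  can be new is \<open>P\<close> after an extension, and its children cover it.\<close>

lemma covering_process:
  assumes expl: "explored s E" and cov: "covering s" and P: "P \<in> todo s"
  shows "covering (process P s)"
proof -
  note keep = covered_process[OF expl cov P]
  have org: "\<exists>n. covered (process P s) (path_resource x R) n"
    if "awalk org R dst" "open_resource (process P s) (path_resource x R)" for R
    using that cov keep open_resource_process unfolding covering_def by blast
  have old: "covered (process P s) (path_resource x Q + path_resource x R) (length R)"
    if "Q \<in> labels s v" "awalk v R dst"
      "open_resource (process P s) (path_resource x Q + path_resource x R)" for v Q R
    using that cov keep open_resource_process unfolding covering_def by blast
  have "covered (process P s) (path_resource x Q + path_resource x R) (length R)"
    if Q: "Q \<in> labels (process P s) v" and R: "awalk v R dst"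
      and op: "open_resource (process P s) (path_resource x Q + path_resource x R)" for v Q R
  proof (cases "Q \<in> labels s v")
    case True
    then show ?thesis using old R op by blast
  next
    case False
    show ?thesis
    proof (cases rule: process_cases[of P s])
      case improve
      then show ?thesis using Q False by simp
    next
      case extend
      have "Q = P" "v = awlast org P"
        using Q False unfolding extend(4) by (auto split: if_splits)
      then show ?thesis
        using extended_covered[OF extend(1,4)] R op open_resource_process by blast
    next
      case reject
      then show ?thesis using Q False by simp
    qed
  qed
  then show ?thesis unfolding covering_def using org by blast
qed

lemma reachable_invariants:
  assumes "step\<^sup>*\<^sup>* lc_init s"
  shows "\<exists>E. explored s E \<and> covering s"
  using assms
proof induction
  case base
  then show ?case using explored_init covering_init by blast
next
  case (step s s')
  then show ?case using step_process explored_process covering_process by metis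
qed

lemma final_state_correct:
  assumes reach: "step\<^sup>*\<^sup>* lc_init s" and stuck: "\<nexists>s'. step s s'"
  shows "todo s = {} \<and>
    (if \<bar>ub s\<bar> \<noteq> \<infinity>
     then \<exists>P. nondominated_optimal_path D org dst x c \<rho> P \<and> ub s = ereal (c (path_resource x P))
     else \<not> (\<exists>P. feasible_path D org dst x \<rho> P))"
proof -
  obtain E where expl: "explored s E" and cov: "covering s"
    using reachable_invariants[OF reach] by blast
  have empty: "todo s = {}" using stuck_todo_empty[OF expl stuck] .
  \<comment> \<open>A feasible walk below the bound would have an open resource and so a witness in
    the empty list.\<close>
  then have closed: "ub s \<le> ereal (c (path_resource x R))"
    if "feasible_path D org dst x \<rho> R" for R
    using that cov
    by (auto simp: covering_def covered_def feasible_path_def open_resource_def not_less)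
  have bound: "ub s = \<infinity> \<or>
      (\<exists>P. feasible_path D org dst x \<rho> P \<and> ub s = ereal (c (path_resource x P)))"
    using expl unfolding explored_def by blast
  show ?thesis
  \<comment> \<open>By \<open>bound\<close> the value is otherwise the real cost of a feasible path,
    so \<open>-\<infinity>\<close> does not occur and this split agrees with the finiteness
    test.\<close>
  proof (cases "ub s = \<infinity>")
    case True
    then show ?thesis using empty closed by auto
  next
    case False
    then obtain P where P: "feasible_path D org dst x \<rho> P" "ub s = ereal (c (path_resource x P))"
      using bound by blast
    then have "optimal_path D org dst x c \<rho> P"
      using closed by (simp add: optimal_path_def)
    then show ?thesis
      using nondominated_optimal_path_exists empty P by fastforce
  qed
qed

end

theorem theorem5:
  fixes D :: "('v, 'a) pre_digraph"
    and org dst :: 'v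
    and x :: "'a \<Rightarrow> 'r::{lattice_ordered_monoid, conditionally_complete_lattice}"
    and c :: "'r \<Rightarrow> real"
    and \<rho> :: "'r \<Rightarrow> nat"
    and b :: "'v \<Rightarrow> 'r"
  assumes "fin_digraph D"
    and "org \<in> verts D" and "dst \<in> verts D"
    and "mono c"
    and "mono \<rho>" and "range \<rho> \<subseteq> {0, 1}"
    and "\<And>v P. v \<in> verts D \<Longrightarrow> pre_digraph.awalk D v P dst \<Longrightarrow> b v \<le> path_resource x P"
    and "\<And>C. wf_digraph.closed_w D C \<Longrightarrow> 0 \<le> path_resource x C"
  shows "\<not> (\<exists>S. S 0 = lc_init \<and> (\<forall>n. lc_step D org dst x c \<rho> b (S n) (S (Suc n))))
    \<and> (\<forall>s. (lc_step D org dst x c \<rho> b)\<^sup>*\<^sup>* lc_init s \<and> \<not> (\<exists>s'. lc_step D org dst x c \<rho> b s s')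
          \<longrightarrow> todo s = {} \<and>
              (if \<bar>ub s\<bar> \<noteq> \<infinity>
               then \<exists>P. nondominated_optimal_path D org dst x c \<rho> P \<and> ub s = ereal (c (path_resource x P))
               else \<not> (\<exists>P. feasible_path D org dst x \<rho> P)))"
proof -
  interpret fin_digraph D by fact
  interpret resource_constrained_path D org dst x c \<rho> b
    using assms by unfold_locales auto
  show ?thesis using no_infinite_run final_state_correct by blast
qed

end
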